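(* There is a constant $c>0$ and computable Turing functionals $\Theta$ and $\Phi$ such that the following holds. Let $m\ge2$ be an integer, let $\epsilon=\frac1m$, and let $S=\{n_i\}_{i\ge1}$ be a lacunary sequence of positive integers with parameter $1+\frac1m$. Then $\Theta(S,m)=\theta\in(0,1)$ is such that $$\inf_{j\ge1}\lVert\theta n_j\rVert>c\,\epsilon\,|\log\epsilon|^{-1}.$$ Furthermore, $\Phi(\Theta(S,m),\epsilon)$ is a function $\mathbb Z\to\{1,\dots,\lceil c^{-1}\epsilon^{-1}|\log\epsilon|\rceil\}$ which is a proper coloring of the Cayley graph $\mathcal G(S)$.
   Context: A sequence $S=\{n_i\}$ is lacunary with parameter $1+\epsilon$ (for $\epsilon>0$) if $n_{i+1}/n_i>1+\epsilon$ for each $i$. $\mathcal G(S)$ is the graph with vertex set $\mathbb Z$ in which $n$ and $n'$ are joined by an edge if and only if $|n-n'|\in S$. A proper coloring assigns colors to vertices so that every edge joins vertices of different colors. $\lVert\cdot\rVert$ denotes the distance to the nearest integer. $\Theta$ has access to $S$ as an oracle and outputs a real number $\theta$ (via its binary expansion); $\Phi$ has access to the name of $\theta$ so produced. *)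

theory Defs
  imports Complex_Main "HOL-Library.Nat_Bijection"
begin

text \<open>
  Turing functionals are modelled by Kleene's partial recursive functions relative to an oracle
  \<open>A :: nat \<Rightarrow> nat\<close>. A program is a finite code that does not mention the oracle;
  \<open>rec_eval A e xs y\<close> says that \<open>e\<close>, run with oracle \<open>A\<close> on the arguments \<open>xs\<close>,
  halts with result \<open>y\<close>. A wrong number of arguments at an arity-sensitive instruction counts
  as divergence.
\<close>

datatype recf =
    Zero
  | Succ
  | Proj nat
  | Query
  | Comp recf "recf list"
  | PrimRec recf recf
  | Minim recf

inductive rec_eval :: "(nat \<Rightarrow> nat) \<Rightarrow> recf \<Rightarrow> nat list \<Rightarrow> nat \<Rightarrow> bool"
  for A :: "nat \<Rightarrow> nat" where
  zero: "rec_eval A Zero xs 0"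
| succ: "rec_eval A Succ [x] (Suc x)"
| proj: "i < length xs \<Longrightarrow> rec_eval A (Proj i) xs (xs ! i)"
| query: "rec_eval A Query [x] (A x)"
| comp: "list_all2 (\<lambda>g y. rec_eval A g xs y) gs ys \<Longrightarrow> rec_eval A f ys z
    \<Longrightarrow> rec_eval A (Comp f gs) xs z"
| prim_0: "rec_eval A f xs y \<Longrightarrow> rec_eval A (PrimRec f g) (0 # xs) y"
| prim_Suc: "rec_eval A (PrimRec f g) (k # xs) r \<Longrightarrow> rec_eval A g (k # r # xs) y
    \<Longrightarrow> rec_eval A (PrimRec f g) (Suc k # xs) y"
| minim: "rec_eval A f (k # xs) 0 \<Longrightarrow> (\<And>i. i < k \<Longrightarrow> \<exists>y. rec_eval A f (i # xs) (Suc y))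
    \<Longrightarrow> rec_eval A (Minim f) xs k"

lemma rec_eval_deterministic:
  "rec_eval A e xs y \<Longrightarrow> rec_eval A e xs y' \<Longrightarrow> y' = y"
proof (induction arbitrary: y' rule: rec_eval.induct)
  case (zero xs)
  then show ?case by (auto elim: rec_eval.cases)
next
  case (succ x)
  then show ?case by (auto elim: rec_eval.cases)
next
  case (proj i xs)
  from proj(2) show ?case by (auto elim: rec_eval.cases)
next
  case (query x)
  then show ?case by (auto elim: rec_eval.cases)
next
  case (comp xs gs ys f z)
  from comp.prems obtain ys' where
    ys': "list_all2 (\<lambda>g y. rec_eval A g xs y) gs ys'" "rec_eval A f ys' y'"
    by (auto elim: rec_eval.cases)
  have "ys' = ys"
    using comp.IH(1) ys'(1) by (auto simp: list_all2_conv_all_nth intro!: nth_equalityI)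
  then show ?case using comp.IH(2) ys'(2) by simp
next
  case (prim_0 f xs y g)
  from prim_0.prems have "rec_eval A f xs y'" by (auto elim: rec_eval.cases)
  then show ?case by (rule prim_0.IH)
next
  case (prim_Suc f g k xs r y)
  from prim_Suc.prems obtain r' where
    "rec_eval A (PrimRec f g) (k # xs) r'" "rec_eval A g (k # r' # xs) y'"
    by (auto elim: rec_eval.cases)
  then show ?case using prim_Suc.IH by blast
next
  case (minim f k xs)
  from minim.prems have y': "rec_eval A f (y' # xs) 0"
    "\<And>i. i < y' \<Longrightarrow> \<exists>y. rec_eval A f (i # xs) (Suc y)"
    by (auto elim: rec_eval.cases)
  have "\<not> k < y'" using minim.IH(1) y'(2) by fastforce
  moreover have "\<not> y' < k" using minim.IH(2) y'(1) by fastforce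
  ultimately show ?case by simp
qed

text \<open>A functional is an operation from oracles to partial functions, with \<open>None\<close> for divergence.\<close>

definition turing_functional :: "((nat \<Rightarrow> nat) \<Rightarrow> nat list \<Rightarrow> nat option) \<Rightarrow> bool" where
  "turing_functional F \<longleftrightarrow> (\<exists>e. \<forall>A xs y. F A xs = Some y \<longleftrightarrow> rec_eval A e xs y)"

lemma ex1_turing_functional:
  "\<exists>!F. \<forall>A xs y. F A xs = Some y \<longleftrightarrow> rec_eval A e xs y"
proof
  let ?F = "\<lambda>A xs. if \<exists>y. rec_eval A e xs y then Some (THE y. rec_eval A e xs y) else None"
  have "(THE y. rec_eval A e xs y) = y" if "rec_eval A e xs y" for A xs y
    using that rec_eval_deterministic by blast
  then show "\<forall>A xs y. ?F A xs = Some y \<longleftrightarrow> rec_eval A e xs y" by auto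
  show "G = ?F" if "\<forall>A xs y. G A xs = Some y \<longleftrightarrow> rec_eval A e xs y" for G
  proof (intro ext)
    fix A xs
    show "G A xs = ?F A xs"
      using that \<open>\<forall>A xs y. ?F A xs = Some y \<longleftrightarrow> rec_eval A e xs y\<close>
      by (metis not_None_eq)
  qed
qed

definition set_oracle :: "nat set \<Rightarrow> nat \<Rightarrow> nat" where
  "set_oracle S x = of_bool (x \<in> S)"

text \<open>Digit number \<open>k\<close> (counted from 0) has weight \<open>2 ^ - (k + 1)\<close>; the name of a dyadic
  rational is either of its two expansions.\<close>

definition binary_expansion :: "(nat \<Rightarrow> nat) \<Rightarrow> real \<Rightarrow> bool" where
  "binary_expansion b \<theta> \<longleftrightarrow> range b \<subseteq> {0, 1} \<and> (\<lambda>k. real (b k) / 2 ^ (k + 1)) sums \<theta>"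

text \<open>A positive rational is passed to a program as its numerator and denominator in lowest
  terms; an integer is passed through the library's bijection \<open>int_encode\<close>.\<close>

definition pos_rat_args :: "rat \<Rightarrow> nat list" where
  "pos_rat_args q = [nat (fst (quotient_of q)), nat (snd (quotient_of q))]"

text \<open>Sequences are indexed from 1; the value at 0 is irrelevant.\<close>

definition lacunary :: "real \<Rightarrow> (nat \<Rightarrow> nat) \<Rightarrow> bool" where
  "lacunary q n \<longleftrightarrow> (\<forall>i\<ge>1. real (n (i + 1)) / real (n i) > q)"

definition dist_nearest_int :: "real \<Rightarrow> real" where
  "dist_nearest_int x = \<bar>x - of_int (round x)\<bar>"

definition cayley_edges :: "nat set \<Rightarrow> (int \<times> int) set" where
  "cayley_edges S = {(x, y). \<bar>x - y\<bar> \<in> int ` S}"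

definition proper_coloring :: "('v \<times> 'v) set \<Rightarrow> ('v \<Rightarrow> 'c) \<Rightarrow> bool" where
  "proper_coloring E f \<longleftrightarrow> (\<forall>(x, y)\<in>E. f x \<noteq> f y)"

end

theory Submission
  imports Defs
begin

text \<open>
  Choose \<open>q\<close> with \<open>N = 2 ^ q\<close> at least \<open>48 m (q + 1)\<close> and of order \<open>m log m\<close>. By lacunarity at most
  \<open>m q\<close> members of \<open>S\<close> lie in \<open>[N ^ (k - 1), N ^ k)\<close>. For such an \<open>n\<close>, the set
  \<open>\<parallel>n x\<parallel> < 1 / N\<close> has period at most \<open>N ^ (1 - k)\<close> and density of order \<open>1 / N\<close>, so all members of the
  block together spoil at most a quarter of any interval of length \<open>N ^ (1 - k)\<close>, while a cell
  of length \<open>N ^ - (k + 1)\<close> resolves whether it is spoiled. Hence one can descend through nested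
  \<open>N\<close>-adic cells, each time picking a child that is unspoiled by the current block and at most half
  of whose own children are spoiled by the next one; a pigeonhole argument on grandchildren shows
  that such a child exists. Each step is a finite search with finitely many oracle queries, and
  \<open>\<theta>\<close> is the limit point. The colouring cuts the circle into \<open>2 N\<close> arcs and looks up the arc of an
  approximation to \<open>\<theta> z\<close>.
\<close>

subsection \<open>Oracle-computable functions\<close>

text \<open>Arguments are passed as an environment \<open>\<rho>\<close>, of which only the first \<open>n\<close> values reach the program;
  a binder then amounts to shifting \<open>\<rho>\<close>, as with de Bruijn indices.\<close>

definition computable :: "nat \<Rightarrow> ((nat \<Rightarrow> nat) \<Rightarrow> (nat \<Rightarrow> nat) \<Rightarrow> nat) \<Rightarrow> bool" where
  "computable n f \<longleftrightarrow> (\<exists>e. \<forall>A \<rho>. rec_eval A e (map \<rho> [0..<n]) (f A \<rho>))"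

lemma computable_turing_functional:
  assumes "computable n f"
  shows "\<exists>F. turing_functional F \<and> (\<forall>A xs. length xs = n \<longrightarrow> F A xs = Some (f A ((!) xs)))"
proof -
  from assms obtain e where e: "rec_eval A e (map \<rho> [0..<n]) (f A \<rho>)" for A \<rho>
    unfolding computable_def by blast
  obtain F where F: "\<forall>A xs y. F A xs = Some y \<longleftrightarrow> rec_eval A e xs y"
    using ex1_turing_functional[of e] by blast
  have "F A xs = Some (f A ((!) xs))" if "length xs = n" for A xs
    using e[of A "(!) xs"] F that by (metis map_nth)
  then show ?thesis using F unfolding turing_functional_def by blast
qed

lemma computable_var: "i < n \<Longrightarrow> computable n (\<lambda>A \<rho>. \<rho> i)"
  unfolding computable_def using rec_eval.proj[of i "map _ [0..<n]"] by force

lemma computable_subst: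
  assumes "computable k f" "\<And>i. i < k \<Longrightarrow> computable n (g i)"
  shows "computable n (\<lambda>A \<rho>. f A (\<lambda>i. g i A \<rho>))"
proof -
  from assms(1) obtain e where e: "rec_eval A e (map \<rho> [0..<k]) (f A \<rho>)" for A \<rho>
    unfolding computable_def by blast
  from assms(2) obtain d where
    d: "i < k \<Longrightarrow> rec_eval A (d i) (map \<rho> [0..<n]) (g i A \<rho>)" for i A \<rho>
    unfolding computable_def by metis
  have "rec_eval A (Comp e (map d [0..<k])) (map \<rho> [0..<n]) (f A (\<lambda>i. g i A \<rho>))" for A \<rho>
    by (rule rec_eval.comp[where ys = "map (\<lambda>i. g i A \<rho>) [0..<k]"])
      (auto simp: list_all2_conv_all_nth d e)
  then show ?thesis unfolding computable_def by blast
qed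

lemma computable1:
  assumes "computable 1 (\<lambda>A \<rho>. f A (\<rho> 0))" "computable n g"
  shows "computable n (\<lambda>A \<rho>. f A (g A \<rho>))"
  using computable_subst[OF assms(1), of n "\<lambda>_. g"] assms by simp

lemma computable2:
  assumes "computable 2 (\<lambda>A \<rho>. f A (\<rho> 0) (\<rho> 1))" "computable n g" "computable n h"
  shows "computable n (\<lambda>A \<rho>. f A (g A \<rho>) (h A \<rho>))"
proof -
  have "computable n ([g, h] ! i)" if "i < 2" for i
    using that assms(2,3) by (auto simp: less_2_cases_iff)
  from computable_subst[where g = "\<lambda>i. [g, h] ! i", OF assms(1) this] show ?thesis by simp
qed

lemma computable3:
  assumes "computable 3 (\<lambda>A \<rho>. f A (\<rho> 0) (\<rho> 1) (\<rho> 2))"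
    "computable n g" "computable n h" "computable n i"
  shows "computable n (\<lambda>A \<rho>. f A (g A \<rho>) (h A \<rho>) (i A \<rho>))"
proof -
  have "computable n ([g, h, i] ! j)" if "j < 3" for j
    using that assms(2-4) by (auto simp: less_Suc_eq numeral_eq_Suc)
  from computable_subst[where g = "\<lambda>j. [g, h, i] ! j", OF assms(1) this] show ?thesis
    by (simp add: numeral_eq_Suc)
qed

lemma computable_Suc:
  assumes "computable n f" shows "computable n (\<lambda>A \<rho>. Suc (f A \<rho>))"
proof (rule computable1[OF _ assms])
  show "computable 1 (\<lambda>A \<rho>. Suc (\<rho> 0))"
    unfolding computable_def using rec_eval.succ by (force simp: numeral_eq_Suc)
qed

lemma computable_oracle:
  assumes "computable n f" shows "computable n (\<lambda>A \<rho>. A (f A \<rho>))"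
proof (rule computable1[where f = "\<lambda>A. A", OF _ assms])
  show "computable 1 (\<lambda>A \<rho>. A (\<rho> 0))"
    unfolding computable_def using rec_eval.query by (force simp: numeral_eq_Suc)
qed

lemma computable_const: "computable n (\<lambda>A \<rho>. c)"
proof (induction c)
  case 0
  then show ?case unfolding computable_def using rec_eval.zero by blast
next
  case (Suc c)
  then show ?case by (rule computable_Suc)
qed

lemma computable_rec_nat:
  assumes "computable n b" "computable n c"
    "computable (n + 2) (\<lambda>A \<rho>. s A (\<rho> 0) (\<rho> 1) (\<lambda>i. \<rho> (i + 2)))"
  shows "computable n (\<lambda>A \<rho>. rec_nat (b A \<rho>) (\<lambda>k r. s A k r \<rho>) (c A \<rho>))"
proof -
  from assms obtain eb ec es where
    eb: "\<And>A \<rho>. rec_eval A eb (map \<rho> [0..<n]) (b A \<rho>)" and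
    ec: "\<And>A \<rho>. rec_eval A ec (map \<rho> [0..<n]) (c A \<rho>)" and
    es: "\<And>A \<rho>. rec_eval A es (map \<rho> [0..<n + 2]) (s A (\<rho> 0) (\<rho> 1) (\<lambda>i. \<rho> (i + 2)))"
    unfolding computable_def by metis
  have env: "map (\<lambda>i. if i = 0 then k else if i = 1 then r else \<rho> (i - 2)) [0..<n + 2]
      = k # r # map \<rho> [0..<n]" for k r :: nat and \<rho>
    by (rule nth_equalityI) (auto simp: nth_Cons simp del: upt_Suc split: nat.splits)
  have step: "rec_eval A es (k # r # map \<rho> [0..<n]) (s A k r \<rho>)" for A k r \<rho>
    using es[of A "\<lambda>i. if i = 0 then k else if i = 1 then r else \<rho> (i - 2)"]
    unfolding env by simp
  have rec: "rec_eval A (PrimRec eb es) (k # map \<rho> [0..<n])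
      (rec_nat (b A \<rho>) (\<lambda>k r. s A k r \<rho>) k)" for A k \<rho>
    by (induction k) (auto intro: rec_eval.prim_0 rec_eval.prim_Suc eb step)
  have "rec_eval A (Comp (PrimRec eb es) (ec # map Proj [0..<n])) (map \<rho> [0..<n])
      (rec_nat (b A \<rho>) (\<lambda>k r. s A k r \<rho>) (c A \<rho>))" for A \<rho>
  proof (rule rec_eval.comp[OF _ rec])
    have "rec_eval A (Proj i) (map \<rho> [0..<n]) (\<rho> i)" if "i < n" for i
      using rec_eval.proj[of i "map \<rho> [0..<n]" A] that by simp
    then show "list_all2 (\<lambda>g y. rec_eval A g (map \<rho> [0..<n]) y) (ec # map Proj [0..<n])
        (c A \<rho> # map \<rho> [0..<n])"
      by (auto simp: list_all2_conv_all_nth nth_Cons ec split: nat.splits)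
  qed
  then show ?thesis unfolding computable_def by blast
qed

named_theorems computable_intros
lemmas [computable_intros] = computable_var computable_const computable_Suc computable_oracle

lemma computable_add [computable_intros]:
  assumes "computable n f" "computable n g" shows "computable n (\<lambda>A \<rho>. f A \<rho> + g A \<rho>)"
proof (rule computable2[where f = "\<lambda>A x y. x + y", OF _ assms])
  have "rec_nat y (\<lambda>k r. Suc r) x = x + y" for x y :: nat by (induction x) auto
  moreover have "computable 2 (\<lambda>A \<rho>. rec_nat (\<rho> 1) (\<lambda>k r. Suc r) (\<rho> 0))"
    by (intro computable_rec_nat computable_intros) auto
  ultimately show "computable 2 (\<lambda>A \<rho>. \<rho> 0 + \<rho> 1)" by simp
qed

lemma computable_mult [computable_intros]:
  assumes "computable n f" "computable n g" shows "computable n (\<lambda>A \<rho>. f A \<rho> * g A \<rho>)"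
proof (rule computable2[where f = "\<lambda>A x y. x * y", OF _ assms])
  have "rec_nat 0 (\<lambda>k r. y + r) x = x * y" for x y :: nat by (induction x) auto
  moreover have "computable 2 (\<lambda>A \<rho>. rec_nat 0 (\<lambda>k r. \<rho> 1 + r) (\<rho> 0))"
    by (intro computable_rec_nat computable_intros) auto
  ultimately show "computable 2 (\<lambda>A \<rho>. \<rho> 0 * \<rho> 1)" by simp
qed

lemma computable_power [computable_intros]:
  assumes "computable n f" "computable n g" shows "computable n (\<lambda>A \<rho>. f A \<rho> ^ g A \<rho>)"
proof (rule computable2[where f = "\<lambda>A x y. x ^ y", OF _ assms])
  have "rec_nat 1 (\<lambda>k r. x * r) y = x ^ y" for x y :: nat by (induction y) auto
  moreover have "computable 2 (\<lambda>A \<rho>. rec_nat 1 (\<lambda>k r. \<rho> 0 * r) (\<rho> 1))"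
    by (intro computable_rec_nat computable_intros) auto
  ultimately show "computable 2 (\<lambda>A \<rho>. \<rho> 0 ^ \<rho> 1)" by simp
qed

lemma computable_diff [computable_intros]:
  assumes "computable n f" "computable n g" shows "computable n (\<lambda>A \<rho>. f A \<rho> - g A \<rho>)"
proof (rule computable2[where f = "\<lambda>A x y. x - y", OF _ assms])
  have pred: "rec_nat 0 (\<lambda>k r. k) x = x - 1" for x :: nat by (cases x) auto
  have "computable 1 (\<lambda>A \<rho>. rec_nat 0 (\<lambda>k r. k) (\<rho> 0))"
    by (intro computable_rec_nat computable_intros) auto
  then have cpred: "computable n (\<lambda>A \<rho>. h A \<rho> - 1)" if "computable n h" for n h
    using computable1[where f = "\<lambda>A x. x - 1", OF _ that] by (simp add: pred)
  have "rec_nat x (\<lambda>k r. r - 1) y = x - y" for x y :: nat by (induction y) auto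
  moreover have "computable 2 (\<lambda>A \<rho>. rec_nat (\<rho> 0) (\<lambda>k r. r - 1) (\<rho> 1))"
    by (intro computable_rec_nat cpred computable_intros) auto
  ultimately show "computable 2 (\<lambda>A \<rho>. \<rho> 0 - \<rho> 1)" by simp
qed

text \<open>Predicates are carried as 0/1-valued functions, so connectives and bounded quantifiers
  reduce to arithmetic and bounded sums.\<close>

lemma computable_not [computable_intros]:
  assumes "computable n (\<lambda>A \<rho>. of_bool (P A \<rho>))"
  shows "computable n (\<lambda>A \<rho>. of_bool (\<not> P A \<rho>))"
proof -
  have "computable n (\<lambda>A \<rho>. 1 - of_bool (P A \<rho>))" by (intro computable_intros assms)
  moreover have "of_bool (\<not> b) = 1 - (of_bool b :: nat)" for b by simp
  ultimately show ?thesis by simp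
qed

lemma computable_conj [computable_intros]:
  assumes "computable n (\<lambda>A \<rho>. of_bool (P A \<rho>))" "computable n (\<lambda>A \<rho>. of_bool (Q A \<rho>))"
  shows "computable n (\<lambda>A \<rho>. of_bool (P A \<rho> \<and> Q A \<rho>))"
  unfolding of_bool_conj by (intro computable_intros assms)

lemma computable_le [computable_intros]:
  assumes "computable n f" "computable n g"
  shows "computable n (\<lambda>A \<rho>. of_bool (f A \<rho> \<le> g A \<rho>))"
proof -
  have eq: "of_bool (x \<le> y) = 1 - (x - y)" for x y :: nat by auto
  show ?thesis unfolding eq by (intro computable_intros assms)
qed

lemma computable_less [computable_intros]:
  assumes "computable n f" "computable n g"
  shows "computable n (\<lambda>A \<rho>. of_bool (f A \<rho> < g A \<rho>))"
  unfolding Suc_le_eq[symmetric] by (intro computable_intros assms)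

text \<open>Inserts a slot at position 1: the accumulator of a recursion
  (\<open>computable_sum\<close>) or the variable of an enclosing binder
  (\<open>computable_first_below\<close>) sits there.\<close>

lemma computable_weaken:
  assumes "computable (Suc n) (\<lambda>A \<rho>. f A (\<rho> 0) (\<lambda>i. \<rho> (Suc i)))"
  shows "computable (n + 2) (\<lambda>A \<rho>. f A (\<rho> 0) (\<lambda>i. \<rho> (i + 2)))"
proof -
  have "computable (n + 2) (\<lambda>A \<rho>. \<rho> (if i = 0 then 0 else Suc i))" if "i < Suc n" for i
    using that by (intro computable_var) auto
  from computable_subst[where g = "\<lambda>i A \<rho>. \<rho> (if i = 0 then 0 else Suc i)", OF assms this]
  show ?thesis by simp
qed

lemma computable_sum [computable_intros]:
  assumes "computable n b" "computable (Suc n) (\<lambda>A \<rho>. f A (\<rho> 0) (\<lambda>i. \<rho> (Suc i)))"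
  shows "computable n (\<lambda>A \<rho>. \<Sum>i<b A \<rho>. f A i \<rho>)"
proof -
  from computable_weaken[where f = f, OF assms(2)]
  have "computable n (\<lambda>A \<rho>. rec_nat 0 (\<lambda>k r. r + f A k \<rho>) (b A \<rho>))"
    by (intro computable_rec_nat computable_intros assms) auto
  moreover have "rec_nat 0 (\<lambda>k r. r + f A k \<rho>) c = (\<Sum>i<c. f A i \<rho>)" for A \<rho> c
    by (induction c) auto
  ultimately show ?thesis by simp
qed

lemma computable_ex_less [computable_intros]:
  assumes "computable n b" "computable (Suc n) (\<lambda>A \<rho>. of_bool (P A (\<rho> 0) (\<lambda>i. \<rho> (Suc i))))"
  shows "computable n (\<lambda>A \<rho>. of_bool (\<exists>i<b A \<rho>. P A i \<rho>))"
proof -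
  have eq: "of_bool (\<exists>i<c. Q i) = (of_bool (0 < (\<Sum>i<c. of_bool (Q i) :: nat)) :: nat)"
    for c and Q :: "nat \<Rightarrow> bool"
    by (induction c) (auto simp: less_Suc_eq)
  show ?thesis unfolding eq by (intro computable_intros assms)
qed

lemma computable_div [computable_intros]:
  assumes "computable n f" "computable n g"
  shows "computable n (\<lambda>A \<rho>. f A \<rho> div g A \<rho>)"
proof (rule computable2[where f = "\<lambda>A x y. x div y", OF _ assms])
  \<comment> \<open>Counts the positive multiples of \<open>y\<close> up to \<open>x\<close>;
    \<open>0 < y\<close> makes the count agree with \<open>x div 0 = 0\<close>.\<close>
  have eq: "x div y = (\<Sum>i<x. of_bool (0 < y \<and> Suc i * y \<le> x))" for x y :: nat
  proof (cases "y = 0")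
    case False
    then have "i < x \<and> 0 < y \<and> Suc i * y \<le> x \<longleftrightarrow> i < x div y" for i
      using less_eq_div_iff_mult_less_eq[of y "Suc i" x] div_le_dividend[of x y] by linarith
    then have "{i. i < x \<and> 0 < y \<and> Suc i * y \<le> x} = {..<x div y}" by blast
    then show ?thesis by (simp add: of_bool_def sum.If_cases Int_def)
  qed simp
  show "computable 2 (\<lambda>A \<rho>. \<rho> 0 div \<rho> 1)"
    unfolding eq by (intro computable_intros) auto
qed

lemma computable_mod [computable_intros]:
  assumes "computable n f" "computable n g"
  shows "computable n (\<lambda>A \<rho>. f A \<rho> mod g A \<rho>)"
  unfolding minus_div_mult_eq_mod[symmetric] by (intro computable_intros assms)

text \<open>The least \<open>i < b\<close> satisfying \<open>P\<close>, or \<open>b\<close> if there is none, written as a count so that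
  its computability reduces to that of bounded sums.\<close>

definition first_below :: "nat \<Rightarrow> (nat \<Rightarrow> bool) \<Rightarrow> nat" where
  "first_below b P = (\<Sum>j<b. of_bool (\<not> (\<exists>i<Suc j. P i)))"

lemma first_below_eq_Least:
  assumes "P i" "i < b" shows "first_below b P = (LEAST i. P i)"
proof -
  have l: "P (LEAST i. P i)" "(LEAST i. P i) \<le> i"
    using assms LeastI Least_le by metis+
  have "j < (LEAST i. P i) \<longleftrightarrow> \<not> (\<exists>i<Suc j. P i)" for j
    using l(1) not_less_Least by (metis less_Suc_eq_le not_less order_le_less_trans)
  then have "j < b \<and> \<not> (\<exists>i<Suc j. P i) \<longleftrightarrow> j < (LEAST i. P i)" for j
    using l(2) assms(2) le_less_trans less_trans by blast
  then have "{j. j < b \<and> \<not> (\<exists>i<Suc j. P i)} = {..<LEAST i. P i}" by blast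
  then show ?thesis
    by (simp add: first_below_def of_bool_def sum.If_cases Int_def del: not_ex)
qed

lemma first_below:
  assumes "\<exists>i<b. P i" shows "first_below b P < b" "P (first_below b P)"
proof -
  obtain i where i: "i < b" "P i" using assms by blast
  then have *: "first_below b P = (LEAST i. P i)" by (intro first_below_eq_Least)
  show "first_below b P < b" using i Least_le[of P i] * by simp
  show "P (first_below b P)" using i LeastI[of P i] * by simp
qed

lemma computable_first_below [computable_intros]:
  assumes "computable n b" "computable (Suc n) (\<lambda>A \<rho>. of_bool (P A (\<rho> 0) (\<lambda>i. \<rho> (Suc i))))"
  shows "computable n (\<lambda>A \<rho>. first_below (b A \<rho>) (\<lambda>i. P A i \<rho>))"
proof -
  from computable_weaken[where f = "\<lambda>A i \<rho>. of_bool (P A i \<rho>)", OF assms(2)] show ?thesis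
    unfolding first_below_def by (intro computable_intros assms) auto
qed

subsection \<open>Nested cells\<close>

text \<open>A cell of level \<open>k\<close> is \<open>[b / N ^ k, (b + 1) / N ^ k]\<close>. In \<open>bad_cell A N k b\<close> the number \<open>b\<close>
  indexes a cell of level \<open>k + 1\<close>. Since \<open>n < N ^ k\<close>, the value \<open>n * x\<close> moves by less than \<open>1 / N\<close>
  over that cell; with \<open>P = N ^ k\<close>, requiring the residue of \<open>n * b\<close> modulo \<open>N * P\<close> to lie in
  \<open>[P, N * P - 2 * P)\<close> therefore keeps \<open>n * x\<close> at distance at least \<open>1 / N\<close> from the integers on all
  of it. The summand \<open>2 * N ^ k\<close> turns the complement into an initial interval of residues.\<close>

definition bad_cell :: "(nat \<Rightarrow> nat) \<Rightarrow> nat \<Rightarrow> nat \<Rightarrow> nat \<Rightarrow> bool" where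
  "bad_cell A N k b \<longleftrightarrow> (\<exists>n<N ^ k. 0 < A n \<and> N ^ k \<le> N * n \<and>
     (n * b + 2 * N ^ k) mod (N * N ^ k) < 3 * N ^ k)"

text \<open>Avoiding bad cells alone could lead into a cell all of whose children are bad; goodness
  is the invariant that excludes such dead ends.\<close>

definition good_cell :: "(nat \<Rightarrow> nat) \<Rightarrow> nat \<Rightarrow> nat \<Rightarrow> nat \<Rightarrow> bool" where
  "good_cell A N k a \<longleftrightarrow> 2 * (\<Sum>i<N. of_bool (bad_cell A N k (N * a + i))) \<le> N"

text \<open>If no child qualified, the offset would be \<open>N\<close> and the result would leave
  cell \<open>a\<close>; \<open>ex_next\<close> excludes this for good \<open>a\<close>.\<close>

definition next_cell :: "(nat \<Rightarrow> nat) \<Rightarrow> nat \<Rightarrow> nat \<Rightarrow> nat \<Rightarrow> nat" where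
  "next_cell A N k a = N * a + first_below N
     (\<lambda>i. \<not> bad_cell A N k (N * a + i) \<and> good_cell A N (Suc k) (N * a + i))"

definition cell :: "(nat \<Rightarrow> nat) \<Rightarrow> nat \<Rightarrow> nat \<Rightarrow> nat" where
  "cell A N = rec_nat 0 (next_cell A N)"

lemma cell_0 [simp]: "cell A N 0 = 0" and cell_Suc: "cell A N (Suc k) = next_cell A N k (cell A N k)"
  by (simp_all add: cell_def)

section \<open>Counting the cells spoiled by a block\<close>

lemma card_window:
  assumes "n > 0"
  shows "card {b. l \<le> n * b + c \<and> n * b + c < l + d} \<le> Suc (d div n)"
proof (cases "\<exists>b. l \<le> n * b + c \<and> n * b + c < l + d")
  case True
  \<comment> \<open>Values of \<open>n * b + c\<close> are \<open>n\<close> apart, so no hit lies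
    more than \<open>d div n\<close> steps after the least one.\<close>
  define B where "B = (LEAST b. l \<le> n * b + c \<and> n * b + c < l + d)"
  have B: "l \<le> n * B + c" unfolding B_def using LeastI_ex[OF True] by blast
  have "b \<in> {B..B + d div n}" if b: "l \<le> n * b + c" "n * b + c < l + d" for b
  proof -
    have "B \<le> b" unfolding B_def using b by (intro Least_le) blast
    moreover have "n * (b - B) \<le> d" using B b \<open>B \<le> b\<close> by (simp add: diff_mult_distrib2)
    then have "b - B \<le> d div n" using assms by (simp add: less_eq_div_iff_mult_less_eq mult.commute)
    ultimately show ?thesis by auto
  qed
  then have "{b. l \<le> n * b + c \<and> n * b + c < l + d} \<subseteq> {B..B + d div n}" by blast
  from card_mono[OF _ this] show ?thesis by simp
next
  case False
  then have "{b. l \<le> n * b + c \<and> n * b + c < l + d} = {}" by blast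
  then show ?thesis by (simp only: card.empty)
qed

text \<open>Each turn of \<open>n * b\<close> around the circle of length \<open>N * P\<close> takes \<open>N * P / n\<close> steps, at most
  \<open>3 * P / n + 1\<close> of which fall into the arc.\<close>

lemma card_arc_hits:
  fixes n N P B :: nat
  assumes "n < P" "P \<le> N * n"
  shows "card {b \<in> {B..<B + N * N}. (n * b + 2 * P) mod (N * P) < 3 * P} \<le> 12 * N"
proof -
  have pos: "n > 0" "P > 0" "N > 0" using assms by (auto intro: Nat.gr0I)
  define M where "M = N * P"
  have M: "M > 0" using pos by (simp add: M_def)
  \<comment> \<open>\<open>N * N\<close> steps of length \<open>n\<close> cover \<open>u\<close>
    full turns of length \<open>N * P\<close> and touch at most two more; each turn has at most
    \<open>v + 1\<close> hits.\<close>
  define u v where "u = N * n div P" and "v = 3 * P div n"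
  define W where "W = {(n * B + 2 * P) div M..(n * (B + N * N) + 2 * P) div M}"
  let ?X = "\<lambda>w. {b. w * M \<le> n * b + 2 * P \<and> n * b + 2 * P < w * M + 3 * P}"
  have "(n * (B + N * N) + 2 * P) div M = (n * B + 2 * P + N * (N * n)) div M"
    by (simp add: algebra_simps)
  also have "\<dots> \<le> (n * B + 2 * P) div M + N * (N * n) div M + 1"
  proof -
    have "(n * B + 2 * P) mod M + N * (N * n) mod M < 2 * M"
      using M by (simp add: mult_2 add_less_mono)
    then have "((n * B + 2 * P) mod M + N * (N * n) mod M) div M < 2"
      by (rule less_mult_imp_div_less)
    then show ?thesis unfolding div_add1_eq[of "n * B + 2 * P"] by simp
  qed
  also have "N * (N * n) div M = u" using pos by (simp add: M_def u_def)
  finally have "card W \<le> u + 2" by (simp add: W_def)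
  moreover have "card (?X w) \<le> v + 1" for w
    using card_window[OF pos(1), of "w * M" "2 * P" "3 * P"] by (simp add: v_def)
  ultimately have "card W * (v + 1) \<le> (u + 2) * (v + 1)" and X: "card (?X w) \<le> v + 1" for w
    by (simp_all only: mult_le_mono1)
  moreover have "(\<Sum>w\<in>W. card (?X w)) \<le> card W * (v + 1)"
    using sum_bounded_above[of W "\<lambda>w. card (?X w)" "v + 1"] X by (simp only: of_nat_id)
  moreover have "card (\<Union>w\<in>W. ?X w) \<le> (\<Sum>w\<in>W. card (?X w))"
    by (rule card_UN_le) (simp add: W_def)
  ultimately have U: "card (\<Union>w\<in>W. ?X w) \<le> (u + 2) * (v + 1)" by linarith
  have sub: "{b \<in> {B..<B + N * N}. (n * b + 2 * P) mod M < 3 * P} \<subseteq> (\<Union>w\<in>W. ?X w)"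
  proof
    fix b assume b: "b \<in> {b \<in> {B..<B + N * N}. (n * b + 2 * P) mod M < 3 * P}"
    let ?w = "(n * b + 2 * P) div M"
    have "?w \<in> W" using b unfolding W_def by (auto intro!: div_le_mono)
    moreover have "(n * b + 2 * P) mod M < 3 * P" using b by simp
    then have "b \<in> ?X ?w"
      using div_mult_mod_eq[of "n * b + 2 * P" M] unfolding mem_Collect_eq by linarith
    ultimately show "b \<in> (\<Union>w\<in>W. ?X w)" by blast
  qed
  have fin: "finite (\<Union>w\<in>W. ?X w)"
  proof -
    have "?X w \<subseteq> {..w * M + 3 * P}" for w
    proof
      fix b assume "b \<in> ?X w"
      then have "b \<le> n * b" "n * b \<le> w * M + 3 * P" using pos by auto
      then show "b \<in> {..w * M + 3 * P}" unfolding atMost_iff by (rule le_trans)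
    qed
    then show ?thesis by (auto simp: W_def intro: finite_subset)
  qed
  have "card {b \<in> {B..<B + N * N}. (n * b + 2 * P) mod M < 3 * P} \<le> (u + 2) * (v + 1)"
    by (rule le_trans[OF card_mono[OF fin sub] U])
  also have "\<dots> \<le> 12 * N"
  proof -
    \<comment> \<open>In \<open>u * v + u + 2 * v + 2\<close> the terms are at most
      \<open>3 * N\<close>, \<open>N\<close>, \<open>6 * N\<close> and \<open>2 * N\<close>:
      \<open>n < P\<close> bounds \<open>u\<close>, and \<open>P \<le> N * n\<close> bounds
      \<open>v\<close>.\<close>
    have uP: "u * P \<le> N * n" and vn: "v * n \<le> 3 * P" by (simp_all add: u_def v_def)
    have "(u * v) * (P * n) \<le> (3 * N) * (P * n)"
      using mult_le_mono[OF uP vn] by (simp add: mult_ac)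
    then have "u * v \<le> 3 * N" using pos by simp
    moreover have "u * P \<le> N * P" using uP assms(1) by (meson le_trans less_imp_le mult_le_mono2)
    then have "u \<le> N" using pos by simp
    moreover have "v * n \<le> 3 * N * n" using vn assms(2) by linarith
    then have "v \<le> 3 * N" using pos by simp
    ultimately show ?thesis using pos by (simp add: algebra_simps)
  qed
  finally show ?thesis by (simp add: M_def)
qed

lemma lacunary_growth:
  assumes "lacunary r n" "r > 0" "\<forall>i\<ge>1. n i > 0" "i \<ge> 1"
  shows "real (n (i + j)) \<ge> r ^ j * real (n i)"
proof (induction j)
  case (Suc j)
  have "real (n (i + j + 1)) / real (n (i + j)) > r" "n (i + j) > 0"
    using assms by (simp_all add: lacunary_def)
  then have "real (n (i + j + 1)) \<ge> r * real (n (i + j))"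
    by (simp add: field_simps)
  moreover have "r * (r ^ j * real (n i)) \<le> r * real (n (i + j))"
    using Suc assms(2) by (intro mult_left_mono) auto
  ultimately have "r * (r ^ j * real (n i)) \<le> real (n (i + j + 1))" by (rule order_trans[rotated])
  then show ?case by (simp only: power_Suc mult.assoc) simp
qed simp

text \<open>\<open>m * q\<close> indices after the least one in the block the sequence has grown by
  at least \<open>((1 + 1 / m) ^ m) ^ q\<close>, which is at least \<open>2 ^ q\<close> by
  Bernoulli, and so has left the block.\<close>

lemma lacunary_block:
  assumes "m \<ge> 1" "\<forall>i\<ge>1. n i > 0" "lacunary (1 + 1 / real m) n"
  shows "finite {s \<in> n ` {1..}. s < P \<and> P \<le> 2 ^ q * s}" (is "finite ?F")
    and "card {s \<in> n ` {1..}. s < P \<and> P \<le> 2 ^ q * s} \<le> m * q"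
proof -
  show "finite ?F" by (rule finite_subset[of _ "{..<P}"]) auto
  define J where "J = {i. i \<ge> 1 \<and> n i < P \<and> P \<le> 2 ^ q * n i}"
  have F: "?F = n ` J" by (auto simp: J_def)
  show "card ?F \<le> m * q"
  proof (cases "J = {}")
    case True then show ?thesis unfolding F by simp
  next
    case False
    define i where "i = (LEAST i. i \<in> J)"
    have i: "i \<in> J" unfolding i_def using False by (metis LeastI_ex ex_in_conv)
    have "J \<subseteq> {i..<i + m * q}"
    proof
      fix l assume l: "l \<in> J"
      have "i \<le> l" unfolding i_def using l by (rule Least_le)
      moreover have "l < i + m * q"
      proof (rule ccontr)
        assume "\<not> l < i + m * q"
        then obtain j where j: "l = i + j" "m * q \<le> j" using \<open>i \<le> l\<close>
          by (metis add_le_cancel_left le_iff_add not_less)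
        have "2 \<le> (1 + 1 / real m) ^ m"
          using Bernoulli_inequality[of "1 / real m" m] assms(1) order_trans[of "-1" 0 "1 / real m"] by simp
        then have "2 ^ q \<le> (1 + 1 / real m) ^ (m * q)"
          unfolding power_mult by (intro power_mono) auto
        also have "\<dots> \<le> (1 + 1 / real m) ^ j" using j(2) by (intro power_increasing) auto
        finally have "2 ^ q * real (n i) \<le> (1 + 1 / real m) ^ j * real (n i)"
          by (intro mult_right_mono) auto
        also have "\<dots> \<le> real (n (i + j))"
          using i assms by (intro lacunary_growth) (auto simp: J_def add_pos_nonneg)
        finally have "real (2 ^ q * n i) \<le> real (n l)" using j by simp
        then have "2 ^ q * n i \<le> n l" by (simp only: of_nat_le_iff)
        then show False using i l by (auto simp: J_def)
      qed
      ultimately show "l \<in> {i..<i + m * q}" by simp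
    qed
    from card_mono[OF _ this] have "card J \<le> m * q" "finite J"
      using \<open>J \<subseteq> _\<close> finite_subset by auto
    then show ?thesis unfolding F using card_image_le le_trans by blast
  qed
qed

section \<open>The descent through nested cells\<close>

locale lacunary_cells =
  fixes m q N :: nat and n :: "nat \<Rightarrow> nat" and A :: "nat \<Rightarrow> nat"
  assumes m: "m \<ge> 1" and N: "N = 2 ^ q" and large: "48 * m * Suc q \<le> N"
    and n_pos: "\<forall>i\<ge>1. n i > 0" and lac: "lacunary (1 + 1 / real m) n"
    and A: "0 < A s \<longleftrightarrow> s \<in> n ` {1..}"
begin

lemma N_pos: "N > 0" by (simp add: N)

text \<open>Union bound: at most \<open>m * q\<close> members in the block, each with at most
  \<open>12 * N\<close> hits, and \<open>4 * 12 = 48\<close> is the constant in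
  \<open>large\<close>. The range will be the grandchildren of a cell.\<close>

lemma few_bad: "4 * (\<Sum>b = B..<B + N * N. of_bool (bad_cell A N k b)) \<le> N * N"
proof -
  let ?F = "{s \<in> n ` {1..}. s < N ^ k \<and> N ^ k \<le> 2 ^ q * s}"
  let ?H = "\<lambda>s. {b \<in> {B..<B + N * N}. (s * b + 2 * N ^ k) mod (N * N ^ k) < 3 * N ^ k}"
  have "(\<Sum>b = B..<B + N * N. of_bool (bad_cell A N k b)) = card {b \<in> {B..<B + N * N}. bad_cell A N k b}"
    by (simp add: of_bool_def sum.If_cases Int_def conj_commute)
  also have "{b \<in> {B..<B + N * N}. bad_cell A N k b} = (\<Union>s\<in>?F. ?H s)"
    unfolding bad_cell_def A N by blast
  also have "card \<dots> \<le> (\<Sum>s\<in>?F. card (?H s))"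
    by (rule card_UN_le[OF lacunary_block(1)[OF m n_pos lac]])
  also have "\<dots> \<le> card ?F * (12 * N)"
    using sum_bounded_above[of ?F "\<lambda>s. card (?H s)" "12 * N"] card_arc_hits[of _ "N ^ k" N B]
    by (simp add: N)
  also have "\<dots> \<le> m * q * (12 * N)"
    by (rule mult_le_mono1[OF lacunary_block(2)[OF m n_pos lac]])
  finally have "4 * (\<Sum>b = B..<B + N * N. of_bool (bad_cell A N k b)) \<le> 4 * (m * q * (12 * N))"
    by (rule mult_le_mono2)
  also have "\<dots> = 48 * m * q * N" by simp
  also have "\<dots> \<le> N * N" using large by (intro mult_le_mono1) simp
  finally show ?thesis .
qed

text \<open>At least half of the \<open>N\<close> children of a good cell are not bad. If none of these were good, more
  than a quarter of the \<open>N * N\<close> grandchildren would be bad at the next level.\<close>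

lemma ex_next:
  assumes "good_cell A N k a"
  shows "\<exists>i<N. \<not> bad_cell A N k (N * a + i) \<and> good_cell A N (Suc k) (N * a + i)"
proof (rule ccontr)
  assume contra: "\<not> ?thesis"
  define cnt where "cnt i = (\<Sum>j<N. of_bool (bad_cell A N (Suc k) (N * (N * a + i) + j)) :: nat)" for i
  \<comment> \<open>By \<open>contra\<close> a child that is not bad is not good, so twice its count
    exceeds \<open>N\<close>. The extra one in \<open>Suc N\<close> makes the final contradiction
    strict.\<close>
  have *: "Suc N * of_bool (\<not> bad_cell A N k (N * a + i)) \<le> 2 * cnt i" if "i < N" for i
    using contra that by (auto simp: good_cell_def cnt_def not_le)
  have "Suc N * (\<Sum>i<N. of_bool (\<not> bad_cell A N k (N * a + i))) \<le> 2 * (\<Sum>i<N. cnt i)"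
    unfolding sum_distrib_left by (intro sum_mono *) simp
  moreover have "(\<Sum>i<N. of_bool (\<not> bad_cell A N k (N * a + i)) :: nat)
      + (\<Sum>i<N. of_bool (bad_cell A N k (N * a + i))) = (\<Sum>i<N. 1)"
    unfolding sum.distrib[symmetric] by (rule sum.cong) auto
  then have "N \<le> 2 * (\<Sum>i<N. of_bool (\<not> bad_cell A N k (N * a + i)))"
    using assms by (simp add: good_cell_def)
  then have "Suc N * N \<le> 2 * (Suc N * (\<Sum>i<N. of_bool (\<not> bad_cell A N k (N * a + i))))"
    by (metis mult.left_commute mult_le_mono2)
  moreover have "(\<Sum>i<N. cnt i) = (\<Sum>b = N * (N * a)..<N * (N * a) + N * N. of_bool (bad_cell A N (Suc k) b))"
  proof -
    let ?f = "\<lambda>b. of_bool (bad_cell A N (Suc k) (N * (N * a) + b)) :: nat"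
    have "cnt i = sum ?f {i * N..<i * N + N}" for i
      unfolding cnt_def
      using sum.shift_bounds_nat_ivl[of ?f 0 "i * N" N]
      by (simp add: algebra_simps lessThan_atLeast0)
    then have "(\<Sum>i<N. cnt i) = sum ?f {..<N * N}" by (simp only: sum.nat_group)
    also have "\<dots> = (\<Sum>b = N * (N * a)..<N * (N * a) + N * N. of_bool (bad_cell A N (Suc k) b))"
      using sum.shift_bounds_nat_ivl[of "\<lambda>b. of_bool (bad_cell A N (Suc k) b) :: nat" 0 "N * (N * a)" "N * N"]
      by (simp only: lessThan_atLeast0 add.commute[of _ "N * (N * a)"] add_0_right)
    finally show ?thesis .
  qed
  ultimately have "Suc N * N \<le> N * N" using few_bad[where B = "N * (N * a)" and k = "Suc k"] by linarith
  then show False using N_pos by simp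
qed

lemma good_cell_cell: "good_cell A N k (cell A N k)"
proof (induction k)
  case 0
  \<comment> \<open>At level 0 the block would require \<open>n < 1\<close> and
    \<open>1 \<le> N * n\<close>, so nothing is bad.\<close>
  then show ?case by (simp add: good_cell_def bad_cell_def)
next
  case (Suc k)
  then show ?case unfolding cell_Suc next_cell_def by (rule first_below(2)[OF ex_next, THEN conjunct2])
qed

lemma not_bad_cell: "\<not> bad_cell A N k (cell A N (Suc k))"
  unfolding cell_Suc next_cell_def
  by (rule first_below(2)[OF ex_next[OF good_cell_cell], THEN conjunct1])

lemma cell_Suc_div: "cell A N (Suc k) div N = cell A N k"
  unfolding cell_Suc next_cell_def
  using first_below(1)[OF ex_next[OF good_cell_cell, of k]] N_pos by simp

end

section \<open>Choice of the base\<close>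

definition digits_per_level :: "nat \<Rightarrow> nat" where
  "digits_per_level m = first_below (Suc (96 * m)) (\<lambda>q. 48 * m * Suc q \<le> 2 ^ q)"

lemma square_le_power2: "4 \<le> n \<Longrightarrow> n * n \<le> (2::nat) ^ n"
proof (induction n rule: nat_induct_at_least)
  case (Suc n)
  then have "4 * n \<le> n * n" by simp
  moreover have "Suc n * Suc n = n * n + 2 * n + 1" by simp
  ultimately have "Suc n * Suc n \<le> 2 * (n * n)" using Suc.hyps by linarith
  also have "\<dots> \<le> 2 * 2 ^ n" using Suc by simp
  finally show ?case by simp
qed simp

text \<open>Upper bound: minimality of \<open>q\<close> gives \<open>2 ^ q \<le> 96 * m * q\<close>.
  With \<open>q * q \<le> 2 ^ q\<close> this yields first \<open>q \<le> 96 * m\<close>, then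
  \<open>2 ^ q \<le> (96 * m) ^ 2 \<le> m ^ 16\<close>, hence \<open>q \<le> 32 * ln m\<close>;
  putting this back gives \<open>3072 = 96 * 32\<close>.\<close>

lemma
  assumes "m \<ge> 2"
  shows digits_per_level_large: "48 * m * Suc (digits_per_level m) \<le> 2 ^ digits_per_level m"
    and digits_per_level_ln: "2 ^ digits_per_level m \<le> 3072 * real m * ln (real m)"
proof -
  let ?Q = "\<lambda>q. 48 * m * Suc q \<le> 2 ^ q"
  define q where "q = digits_per_level m"
  \<comment> \<open>The search bound suffices, since \<open>q = 96 * m\<close> already
    qualifies.\<close>
  have "48 * m * Suc (96 * m) \<le> (96 * m) * (96 * m)" using assms by simp
  also have "\<dots> \<le> 2 ^ (96 * m)" using assms by (intro square_le_power2) simp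
  finally have ex: "?Q (96 * m)" .
  have q: "q = (LEAST q. ?Q q)"
    unfolding q_def digits_per_level_def by (rule first_below_eq_Least[of ?Q, OF ex]) simp
  have Q: "?Q q" unfolding q using ex by (rule LeastI[of ?Q])
  then show "48 * m * Suc (digits_per_level m) \<le> 2 ^ digits_per_level m" by (simp add: q_def)
  have "q \<ge> 4"
  proof (rule ccontr)
    assume "\<not> q \<ge> 4"
    then have "(2::nat) ^ q \<le> 2 ^ 4" by (intro power_increasing) auto
    moreover have "96 \<le> 48 * m * Suc q" using assms mult_le_mono[of 96 "48 * m" 1 "Suc q"] by simp
    ultimately show False using Q by simp
  qed
  then obtain p where p: "q = Suc p" by (cases q) auto
  have "\<not> ?Q p" using not_less_Least[of p ?Q] p q by auto
  then have up: "2 ^ q \<le> 96 * m * q" using p by simp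
  have "q * 2 ^ q \<le> 96 * m * (q * q)" using mult_le_mono2[OF up, of q] by (simp add: mult_ac)
  also have "\<dots> \<le> 96 * m * 2 ^ q" using square_le_power2[OF \<open>q \<ge> 4\<close>] by simp
  finally have "q \<le> 96 * m" by simp
  with up have "2 ^ q \<le> (96 * m) * (96 * m)" using mult_le_mono2 le_trans by blast
  also have "96 \<le> m ^ 7" using power_mono[OF assms, of 7] by simp
  then have "96 * m \<le> m ^ 8" using mult_le_mono1[of 96 "m ^ 7" m] by (simp add: eval_nat_numeral)
  then have "(96 * m) * (96 * m) \<le> m ^ 8 * m ^ 8" by (rule mult_le_mono) fact
  finally have "2 ^ q \<le> m ^ 16" by (simp flip: power_add)
  then have "real (2 ^ q) \<le> real (m ^ 16)" by (simp only: of_nat_le_iff)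
  then have "ln (2 ^ q) \<le> ln (real m ^ 16)" using assms by (subst ln_le_cancel_iff) auto
  then have ln1: "real q * ln 2 \<le> 16 * ln (real m)" using assms by (simp add: ln_realpow)
  have "ln (1 / 2) \<le> 1 / 2 - (1::real)" by (rule ln_le_minus_one) simp
  then have "1 / 2 \<le> ln (2::real)" by (simp add: ln_div)
  from mult_left_mono[OF this, of "real q"] ln1 have ln2: "real q \<le> 32 * ln (real m)" by simp
  have "real (2 ^ q) \<le> real (96 * m * q)" using up by (simp only: of_nat_le_iff)
  also have "\<dots> \<le> 96 * real m * (32 * ln (real m))"
    using mult_left_mono[OF ln2, of "96 * real m"] by simp
  finally show "2 ^ digits_per_level m \<le> 3072 * real m * ln (real m)" by (simp add: q_def)
qed

subsection \<open>Binary expansions\<close>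

primrec truncation :: "(nat \<Rightarrow> nat) \<Rightarrow> nat \<Rightarrow> nat" where
  "truncation b 0 = 0"
| "truncation b (Suc k) = 2 * truncation b k + b k"

lemma ex_binary_expansion:
  assumes "range b \<subseteq> {0, 1}"
  shows "\<exists>\<theta>. binary_expansion b \<theta>"
proof -
  have "b k \<in> {0, 1}" for k using assms by blast
  then have b: "b k \<le> 1" for k by (metis empty_iff insert_iff le_refl zero_le)
  have "summable (\<lambda>k. real (b k) / 2 ^ (k + 1))"
  proof (rule summable_comparison_test')
    show "summable (\<lambda>k. (1 / 2) ^ k :: real)" by (rule summable_geometric) simp
    show "norm (real (b k) / 2 ^ (k + 1)) \<le> (1 / 2) ^ k" if "k \<ge> 0" for k
      using b[of k] by (simp add: power_one_over field_simps)
  qed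
  then show ?thesis unfolding binary_expansion_def using assms by (blast intro: summable_sums)
qed

lemma binary_expansion_digit_le:
  assumes "binary_expansion b \<theta>"
  shows "b i \<le> 1"
proof -
  have "b i \<in> {0, 1}" using assms unfolding binary_expansion_def by blast
  then show ?thesis by auto
qed

lemma truncation_less:
  assumes "\<And>i. b i \<le> 1"
  shows "truncation b k < 2 ^ k"
proof (induction k)
  case (Suc k)
  then show ?case using assms[of k] by simp
qed simp

text \<open>Further digits keep the dyadic interval inside the earlier one (\<open>lo\<close>,
  \<open>hi\<close>), so the limit stays in it. The upper bound is attained when all later digits
  are 1.\<close>

lemma
  assumes "binary_expansion b \<theta>"
  shows truncation_le: "real (truncation b k) \<le> 2 ^ k * \<theta>"
    and le_truncation: "2 ^ k * \<theta> \<le> real (truncation b k) + 1"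
proof -
  note b = binary_expansion_digit_le[OF assms]
  have "(\<Sum>i<k. real (b i) / 2 ^ (i + 1)) = truncation b k / 2 ^ k" for k
    by (induction k) (simp_all add: field_simps)
  then have lim: "(\<lambda>k. real (truncation b k) / 2 ^ k) \<longlonglongrightarrow> \<theta>"
    using assms by (simp add: binary_expansion_def sums_def)
  have lo: "2 ^ j * truncation b k \<le> truncation b (k + j)"
    and hi: "truncation b (k + j) + 1 \<le> 2 ^ j * (truncation b k + 1)" for j
  proof (induction j)
    case (Suc j)
    { case 1
      show ?case using Suc(1) by simp
    next
      case 2
      show ?case using Suc(2) b[of "k + j"] by simp
    }
  qed simp_all
  have "real (truncation b k) / 2 ^ k \<le> \<theta>"
  proof (rule LIMSEQ_le_const[OF lim], intro exI allI impI)
    fix l assume "k \<le> l"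
    then obtain j where l: "l = k + j" by (metis le_iff_add)
    have "real (2 ^ j * truncation b k) \<le> real (truncation b l)"
      unfolding l using lo by (simp only: of_nat_le_iff)
    then show "real (truncation b k) / 2 ^ k \<le> real (truncation b l) / 2 ^ l"
      by (simp add: l power_add field_simps)
  qed
  then show "real (truncation b k) \<le> 2 ^ k * \<theta>" by (simp add: field_simps)
  have "\<theta> \<le> (real (truncation b k) + 1) / 2 ^ k"
  proof (rule LIMSEQ_le_const2[OF lim], intro exI allI impI)
    fix l assume "k \<le> l"
    then obtain j where l: "l = k + j" by (metis le_iff_add)
    have "real (truncation b l + 1) \<le> real (2 ^ j * (truncation b k + 1))"
      unfolding l using hi by (simp only: of_nat_le_iff)
    then have "real (truncation b l) \<le> 2 ^ j * (real (truncation b k) + 1)"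
      by (simp add: algebra_simps)
    then show "real (truncation b l) / 2 ^ l \<le> (real (truncation b k) + 1) / 2 ^ k"
      by (simp add: l power_add field_simps)
  qed
  then show "2 ^ k * \<theta> \<le> real (truncation b k) + 1" by (simp add: field_simps)
qed

text \<open>The cell of level \<open>Suc k\<close> has \<open>q * Suc k\<close> binary digits;
  shifting out all but the first \<open>Suc k\<close> and reducing modulo 2 leaves digit number
  \<open>k\<close>.\<close>

definition digit :: "(nat \<Rightarrow> nat) \<Rightarrow> nat \<Rightarrow> nat \<Rightarrow> nat" where
  "digit A q k = cell A (2 ^ q) (Suc k) div 2 ^ ((q - 1) * Suc k) mod 2"

context lacunary_cells
begin

lemma q_pos: "q > 0"
proof (rule ccontr)
  assume "\<not> q > 0"
  then show False using large m by (simp add: N)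
qed

lemma truncation_digit: "truncation (digit A q) k = cell A N k div 2 ^ ((q - 1) * k)"
proof (induction k)
  case (Suc k)
  have "(2::nat) ^ ((q - 1) * Suc k) * 2 = N * 2 ^ ((q - 1) * k)"
    using q_pos by (cases q) (simp_all add: N power_add)
  then have "cell A N (Suc k) div 2 ^ ((q - 1) * Suc k) div 2 = cell A N (Suc k) div N div 2 ^ ((q - 1) * k)"
    by (simp only: div_mult2_eq[symmetric])
  also have "\<dots> = truncation (digit A q) k" using Suc cell_Suc_div by simp
  finally have "cell A N (Suc k) div 2 ^ ((q - 1) * Suc k) div 2 = truncation (digit A q) k" .
  moreover have "digit A q k = cell A N (Suc k) div 2 ^ ((q - 1) * Suc k) mod 2"
    by (simp add: digit_def N)
  ultimately show ?case unfolding truncation.simps by (metis mult_div_mod_eq)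
qed simp

text \<open>\<open>truncation_digit\<close> reads these digits from the deeper cell of level
  \<open>q * k\<close>; nestedness leads back to level \<open>k\<close>.\<close>

lemma truncation_digit_cell: "truncation (digit A q) (q * k) = cell A N k"
proof -
  have "cell A N (k + j) div N ^ j = cell A N k" for j
  proof (induction j)
    case (Suc j)
    have "cell A N (k + Suc j) div N ^ Suc j = cell A N (Suc (k + j)) div N div N ^ j"
      by (simp add: div_mult2_eq)
    with Suc show ?case by (simp add: cell_Suc_div)
  qed simp
  from this[of "(q - 1) * k"] have "cell A N (k + (q - 1) * k) div N ^ ((q - 1) * k) = cell A N k" .
  moreover have "k + (q - 1) * k = q * k" using q_pos by (cases q) simp_all
  moreover have "N ^ ((q - 1) * k) = 2 ^ ((q - 1) * (q * k))"
    unfolding N power_mult[symmetric] by (simp only: mult_ac)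
  ultimately show ?thesis by (simp only: truncation_digit)
qed

lemma dist_ge:
  assumes \<theta>: "binary_expansion (digit A q) \<theta>" and i: "i \<ge> 1"
  shows "\<bar>\<theta> * real (n i) - of_int t\<bar> \<ge> 1 / real N"
proof -
  let ?s = "n i"
  have "1 < N" unfolding N by (rule one_less_power) (simp_all add: q_pos)
  then have ex: "?s < N ^ ?s" using power_gt_expt[of N ?s] by simp
  \<comment> \<open>\<open>k\<close> is the block of \<open>n i\<close>:
    \<open>N ^ (k - 1) \<le> n i < N ^ k\<close>, so the cell of level \<open>k + 1\<close> was
    chosen to avoid being spoiled by \<open>n i\<close>.\<close>
  define k where "k = (LEAST k. ?s < N ^ k)"
  have k: "?s < N ^ k" unfolding k_def using ex by (rule LeastI)
  obtain j where j: "k = Suc j" using k n_pos i by (cases k) force+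
  have "\<not> ?s < N ^ j" using not_less_Least[of j "\<lambda>k. ?s < N ^ k"] j by (simp add: k_def)
  then have "N ^ k \<le> N * ?s" by (simp add: j)
  define P b M where "P = N ^ k" and "b = cell A N (Suc k)" and "M = N * P"
  define r w where "r = (?s * b + 2 * P) mod M" and "w = (?s * b + 2 * P) div M"
  have "0 < A ?s" using A i by auto
  then have r: "3 * P \<le> r" using not_bad_cell[of k] k \<open>N ^ k \<le> N * ?s\<close>
    by (auto simp: bad_cell_def r_def P_def b_def M_def not_less)
  have pos: "P > 0" "M > 0" using N_pos by (simp_all add: P_def M_def)
  have "r < M" using pos by (simp add: r_def)
  have eq: "?s * b + 2 * P = w * M + r" by (simp add: r_def w_def)
  have MN: "real M = 2 ^ (q * Suc k)" by (simp add: M_def P_def N power_mult power_add)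
  have lo: "real b \<le> real M * \<theta>" and hi: "real M * \<theta> \<le> real b + 1"
    using truncation_le[OF \<theta>, of "q * Suc k"] le_truncation[OF \<theta>, of "q * Suc k"]
    unfolding truncation_digit_cell MN b_def by simp_all
  have s: "real ?s \<le> real P" using k by (simp add: P_def)
  have eq': "real ?s * real b = real w * real M + real r - 2 * real P"
    using arg_cong[OF eq, of real] by simp
  \<comment> \<open>After undoing the shift by \<open>2 * P\<close>, \<open>r \<ge> 3 * P\<close>
    leaves a margin \<open>P\<close> above \<open>w * M\<close>.\<close>
  have "real M * (\<theta> * real ?s - real w) \<ge> real P"
    using mult_left_mono[OF lo, of "real ?s"] eq' r by (simp add: algebra_simps)
  then have "real P / real M \<le> \<theta> * real ?s - real w"
    using pos by (simp add: field_simps)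
  then have 1: "1 / real N \<le> \<theta> * real ?s - real w" using pos by (simp add: M_def)
  \<comment> \<open>Here \<open>r < M\<close> leaves \<open>2 * P\<close> below
    \<open>(w + 1) * M\<close>, and the passage from \<open>b\<close> to \<open>b + 1\<close> uses
    up at most \<open>n i \<le> P\<close> of it.\<close>
  have "real M * (real w + 1 - \<theta> * real ?s) \<ge> real P"
    using mult_left_mono[OF hi, of "real ?s"] eq' \<open>r < M\<close> s by (simp add: algebra_simps)
  then have "real P / real M \<le> real w + 1 - \<theta> * real ?s"
    using pos by (simp add: field_simps)
  then have 2: "1 / real N \<le> real w + 1 - \<theta> * real ?s" using pos by (simp add: M_def)
  show ?thesis
  proof (cases "t \<le> int w")
    case True
    then have "real_of_int t \<le> real w" by linarith
    with 1 show ?thesis by linarith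
  next
    case False
    then have "real_of_int t \<ge> real w + 1" by linarith
    with 2 show ?thesis by linarith
  qed
qed

text \<open>At 0 or 1 the number \<open>\<theta> * n 1\<close> would be an integer, against
  \<open>dist_ge\<close>.\<close>

lemma expansion_in_unit_interval:
  assumes \<theta>: "binary_expansion (digit A q) \<theta>"
  shows "0 < \<theta>" "\<theta> < 1"
proof -
  have "0 \<le> \<theta>" "\<theta> \<le> 1" using truncation_le[OF \<theta>, of 0] le_truncation[OF \<theta>, of 0] by simp_all
  moreover have "\<theta> \<noteq> 0" using dist_ge[OF \<theta>, of 1 0] N_pos by auto
  moreover have "\<theta> \<noteq> 1" using dist_ge[OF \<theta>, of 1 "int (n 1)"] N_pos by auto
  ultimately show "0 < \<theta>" "\<theta> < 1" by linarith+
qed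

end

subsection \<open>The colouring\<close>

text \<open>Here \<open>x\<close> is the code of \<open>z\<close>: its parity is the sign of \<open>z\<close>, and \<open>\<bar>z\<bar> = Suc x div 2\<close>.\<close>

definition rotation_index :: "(nat \<Rightarrow> nat) \<Rightarrow> nat \<Rightarrow> nat \<Rightarrow> nat" where
  "rotation_index b q x = (let L = x + q + 2; C = truncation b L in
     ((C * (1 - x mod 2) + (2 ^ L - C) * (x mod 2)) * (Suc x div 2)) mod 2 ^ L)"

text \<open>Of the \<open>x + q + 2\<close> bits of the index the leading \<open>q + 1\<close> are
  kept; \<open>Suc\<close> makes colours start at 1.\<close>

definition colour :: "(nat \<Rightarrow> nat) \<Rightarrow> nat \<Rightarrow> nat \<Rightarrow> nat" where
  "colour b q x = Suc (rotation_index b q x div 2 ^ Suc x)"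

lemma colour_le: "colour b q x \<le> 2 ^ Suc q"
proof -
  have "rotation_index b q x < 2 ^ (x + q + 2)"
    unfolding rotation_index_def Let_def by (rule mod_less_divisor) simp
  also have "\<dots> = 2 ^ Suc q * 2 ^ Suc x" by (simp add: power_add)
  finally have "rotation_index b q x < 2 ^ Suc q * 2 ^ Suc x" .
  then show ?thesis unfolding colour_def using less_mult_imp_div_less Suc_leI by blast
qed

text \<open>\<open>L = x + q + 2\<close> digits suffice: the truncation error, at most
  \<open>1 / 2 ^ L\<close>, is multiplied by \<open>\<bar>z\<bar> \<le> 2 ^ x\<close>.\<close>

lemma rotation_index_approx:
  fixes z :: int
  assumes \<theta>: "binary_expansion b \<theta>"
  defines "x \<equiv> int_encode z"
  shows "\<exists>t::int. \<bar>\<theta> * of_int z - of_int t - real (rotation_index b q x) / 2 ^ (x + q + 2)\<bar>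
           \<le> 1 / 2 ^ (q + 2)"
proof -
  define L C w where "L = x + q + 2" and "C = truncation b L" and "w = Suc x div 2"
  have C: "real C \<le> 2 ^ L * \<theta>" "2 ^ L * \<theta> \<le> real C + 1"
    using truncation_le[OF \<theta>, of L] le_truncation[OF \<theta>, of L] by (simp_all add: C_def)
  have "w \<le> x" by (simp add: w_def)
  also have "x \<le> 2 ^ x" using less_exp[of x] by simp
  finally have "w \<le> 2 ^ x" .
  then have w: "real w \<le> 2 ^ x" by (metis of_nat_le_iff of_nat_numeral of_nat_power)
  define d where "d = real w * (\<theta> - real C / 2 ^ L)"
  have nonneg: "0 \<le> \<theta> - real C / 2 ^ L" using C by (simp add: field_simps)
  then have "0 \<le> d" by (simp add: d_def)
  have "\<theta> \<le> (real C + 1) / 2 ^ L" using C by (simp add: pos_le_divide_eq mult.commute)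
  then have "\<theta> - real C / 2 ^ L \<le> 1 / 2 ^ L" by (simp add: add_divide_distrib)
  then have "d \<le> 2 ^ x * (1 / 2 ^ L)" unfolding d_def using w nonneg
    by (intro mult_mono) simp_all
  also have "\<dots> = 1 / 2 ^ (q + 2)" by (simp add: L_def power_add)
  finally have d: "\<bar>d\<bar> \<le> 1 / 2 ^ (q + 2)" using \<open>0 \<le> d\<close> by simp
  let ?y = "rotation_index b q x"
  show ?thesis
  proof (cases "z \<ge> 0")
    case True
    then have x: "x = 2 * nat z" by (simp add: x_def int_encode_def sum_encode_def)
    then have z: "of_int z = real w" using True by (simp add: w_def)
    define t where "t = C * w div 2 ^ L"
    have "?y = C * w mod 2 ^ L"
      using x by (simp add: rotation_index_def Let_def L_def C_def w_def)
    then have "C * w = t * 2 ^ L + ?y" by (simp only: t_def div_mult_mod_eq)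
    then have "real C * real w = real t * 2 ^ L + real ?y"
      by (metis of_nat_add of_nat_mult of_nat_numeral of_nat_power)
    then have "\<theta> * of_int z - of_int (int t) - real ?y / 2 ^ L = d"
      unfolding z d_def by (simp add: field_simps)
    then show ?thesis using d unfolding L_def by metis
  next
    case False
    then have x: "x = 2 * nat (- z - 1) + 1" by (simp add: x_def int_encode_def sum_encode_def)
    then have z: "of_int z = - real w" using False by (simp add: w_def)
    have "z < 0" using False by simp
    \<comment> \<open>Modulo \<open>2 ^ L\<close> the factor \<open>2 ^ L - C\<close> acts as
      \<open>- C\<close>, within the natural numbers; the \<open>w\<close> full turns this adds are
      removed by \<open>int t - int w\<close>.\<close>
    define t where "t = (2 ^ L - C) * w div 2 ^ L"
    have "?y = (2 ^ L - C) * w mod 2 ^ L"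
      using x by (simp add: rotation_index_def Let_def L_def C_def w_def)
    then have y: "(2 ^ L - C) * w = t * 2 ^ L + ?y" by (simp only: t_def div_mult_mod_eq)
    have "C < 2 ^ L"
      unfolding C_def by (rule truncation_less[OF binary_expansion_digit_le[OF \<theta>]])
    then have "(2 ^ L - real C) * real w = real t * 2 ^ L + real ?y"
      using arg_cong[OF y, of real] by (simp add: of_nat_diff)
    then have "\<theta> * of_int z - of_int (int t - int w) - real ?y / 2 ^ L = - d"
      unfolding z d_def by (simp add: field_simps)
    then show ?thesis using d unfolding L_def by (metis abs_minus_cancel)
  qed
qed

text \<open>The colour is the index of an arc of length \<open>2 ^ - (q + 1)\<close> containing an approximation of
  \<open>\<theta> * z\<close> that depends on \<open>z\<close>: rounding a truncation of \<open>\<theta>\<close> avoids deciding in which arc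
  \<open>\<theta> * z\<close> itself lies, which is not computable.\<close>

lemma colour_eq_imp:
  assumes \<theta>: "binary_expansion b \<theta>" and eq: "colour b q (int_encode z) = colour b q (int_encode z')"
  shows "\<exists>t::int. \<bar>\<theta> * of_int (z - z') - of_int t\<bar> < 1 / 2 ^ q"
proof -
  define u where "u z = real (rotation_index b q (int_encode z)) / 2 ^ (int_encode z + q + 2)" for z
  define v where "v z = rotation_index b q (int_encode z) div 2 ^ Suc (int_encode z)" for z
  have u: "real (v z) \<le> 2 ^ Suc q * u z" "2 ^ Suc q * u z < real (v z) + 1" for z
  proof -
    have *: "2 ^ Suc q * u z = real (rotation_index b q (int_encode z)) / real (2 ^ Suc (int_encode z))"
      by (simp add: u_def power_add)
    show "real (v z) \<le> 2 ^ Suc q * u z" unfolding * v_def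
      by (metis floor_divide_of_nat_eq of_int_of_nat_eq of_int_floor_le)
    show "2 ^ Suc q * u z < real (v z) + 1" unfolding * v_def
      by (metis floor_divide_of_nat_eq of_int_of_nat_eq real_of_int_floor_add_one_gt)
  qed
  have "v z = v z'" using eq by (simp add: v_def colour_def)
  then have "\<bar>2 ^ Suc q * u z - 2 ^ Suc q * u z'\<bar> < 1" using u[of z] u[of z'] by linarith
  then have "2 ^ Suc q * \<bar>u z - u z'\<bar> < 1" by (simp add: abs_mult flip: right_diff_distrib)
  then have 1: "\<bar>u z - u z'\<bar> < 1 / 2 ^ Suc q" by (simp add: field_simps)
  obtain t t' :: int where "\<bar>\<theta> * of_int z - of_int t - u z\<bar> \<le> 1 / 2 ^ (q + 2)"
    "\<bar>\<theta> * of_int z' - of_int t' - u z'\<bar> \<le> 1 / 2 ^ (q + 2)"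
    using rotation_index_approx[OF \<theta>, of z q] rotation_index_approx[OF \<theta>, of z' q]
    unfolding u_def by blast
  \<comment> \<open>Arc length and the two approximation errors add up to exactly
    \<open>1 / 2 ^ q\<close>. Strictness comes from the half-open arcs and is what contradicts
    \<open>dist_ge\<close>.\<close>
  with 1 have "\<bar>\<theta> * of_int z - \<theta> * of_int z' - (of_int t - of_int t')\<bar>
      < 1 / 2 ^ Suc q + 1 / 2 ^ (q + 2) + 1 / 2 ^ (q + 2)" by linarith
  also have "\<dots> = 1 / 2 ^ q" by (simp add: field_simps)
  finally show ?thesis by (intro exI[of _ "t - t'"]) (simp add: right_diff_distrib)
qed

subsection \<open>Computability of the construction\<close>

text \<open>Under a binder the environment is shifted, so definitions with binders are unfolded over
  plain variables and arbitrary arguments are substituted afterwards.\<close>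

lemma computable_bad_cell [computable_intros]:
  assumes "computable n f" "computable n g" "computable n h"
  shows "computable n (\<lambda>A \<rho>. of_bool (bad_cell A (f A \<rho>) (g A \<rho>) (h A \<rho>)))"
proof (rule computable3[where f = "\<lambda>A x y z. of_bool (bad_cell A x y z)", OF _ assms])
  show "computable 3 (\<lambda>A \<rho>. of_bool (bad_cell A (\<rho> 0) (\<rho> 1) (\<rho> 2)))"
    unfolding bad_cell_def by (intro computable_intros) auto
qed

lemma computable_good_cell [computable_intros]:
  assumes "computable n f" "computable n g" "computable n h"
  shows "computable n (\<lambda>A \<rho>. of_bool (good_cell A (f A \<rho>) (g A \<rho>) (h A \<rho>)))"
proof (rule computable3[where f = "\<lambda>A x y z. of_bool (good_cell A x y z)", OF _ assms])
  show "computable 3 (\<lambda>A \<rho>. of_bool (good_cell A (\<rho> 0) (\<rho> 1) (\<rho> 2)))"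
    unfolding good_cell_def by (intro computable_intros) auto
qed

lemma computable_next_cell [computable_intros]:
  assumes "computable n f" "computable n g" "computable n h"
  shows "computable n (\<lambda>A \<rho>. next_cell A (f A \<rho>) (g A \<rho>) (h A \<rho>))"
proof (rule computable3[where f = next_cell, OF _ assms])
  show "computable 3 (\<lambda>A \<rho>. next_cell A (\<rho> 0) (\<rho> 1) (\<rho> 2))"
    unfolding next_cell_def by (intro computable_intros) auto
qed

lemma computable_cell [computable_intros]:
  assumes "computable n f" "computable n g"
  shows "computable n (\<lambda>A \<rho>. cell A (f A \<rho>) (g A \<rho>))"
proof (rule computable2[where f = cell, OF _ assms])
  show "computable 2 (\<lambda>A \<rho>. cell A (\<rho> 0) (\<rho> 1))"
    unfolding cell_def by (intro computable_rec_nat computable_intros) auto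
qed

lemma computable_digit [computable_intros]:
  assumes "computable n f" "computable n g"
  shows "computable n (\<lambda>A \<rho>. digit A (f A \<rho>) (g A \<rho>))"
  unfolding digit_def by (intro computable_intros assms)

lemma computable_digits_per_level [computable_intros]:
  assumes "computable n f"
  shows "computable n (\<lambda>A \<rho>. digits_per_level (f A \<rho>))"
proof (rule computable1[where f = "\<lambda>A. digits_per_level", OF _ assms])
  show "computable 1 (\<lambda>A \<rho>. digits_per_level (\<rho> 0))"
    unfolding digits_per_level_def by (intro computable_intros) auto
qed

lemma computable_truncation [computable_intros]:
  assumes "computable n f"
  shows "computable n (\<lambda>A \<rho>. truncation A (f A \<rho>))"
proof (rule computable1[where f = truncation, OF _ assms])
  have "truncation A k = rec_nat 0 (\<lambda>k r. 2 * r + A k) k" for A k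
    by (induction k) auto
  moreover have "computable 1 (\<lambda>A \<rho>. rec_nat 0 (\<lambda>k r. 2 * r + A k) (\<rho> 0))"
    by (intro computable_rec_nat computable_intros) auto
  ultimately show "computable 1 (\<lambda>A \<rho>. truncation A (\<rho> 0))" by simp
qed

lemma computable_colour [computable_intros]:
  assumes "computable n f" "computable n g"
  shows "computable n (\<lambda>A \<rho>. colour A (f A \<rho>) (g A \<rho>))"
  unfolding colour_def rotation_index_def Let_def by (intro computable_intros assms)

section \<open>Assembly of the two functionals\<close>

theorem theorem5p13:
  shows "\<exists>c::real. c > 0 \<and> (\<exists>\<Theta> \<Phi>. turing_functional \<Theta> \<and> turing_functional \<Phi> \<and>
    (\<forall>(m::nat) (\<epsilon>::rat) (n::nat \<Rightarrow> nat) (S::nat set).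
      m \<ge> 2 \<longrightarrow> \<epsilon> = 1 / of_nat m \<longrightarrow>
      (\<forall>i\<ge>1. n i > 0) \<longrightarrow> lacunary (1 + 1 / real m) n \<longrightarrow> S = n ` {1..} \<longrightarrow>
      (\<exists>b \<theta>.
        (\<forall>k. \<Theta> (set_oracle S) [m, k] = Some (b k)) \<and> binary_expansion b \<theta> \<and>
        0 < \<theta> \<and> \<theta> < 1 \<and>
        (INF j\<in>{1..}. dist_nearest_int (\<theta> * real (n j)))
          > c * real_of_rat \<epsilon> * inverse \<bar>ln (real_of_rat \<epsilon>)\<bar> \<and>
        (\<exists>\<chi>::int \<Rightarrow> nat.
          (\<forall>z. \<Phi> b (pos_rat_args \<epsilon> @ [int_encode z]) = Some (\<chi> z)) \<and>
          (\<forall>z. int (\<chi> z) \<in> {1..\<lceil>inverse c * inverse (real_of_rat \<epsilon>) * \<bar>ln (real_of_rat \<epsilon>)\<bar>\<rceil>}) \<and>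
          proper_coloring (cayley_edges S) \<chi>))))"
proof -
  have "computable 2 (\<lambda>A \<rho>. digit A (digits_per_level (\<rho> 0)) (\<rho> 1))"
    by (intro computable_intros) auto
  from computable_turing_functional[OF this] obtain \<Theta> where \<Theta>: "turing_functional \<Theta>"
    "length xs = 2 \<Longrightarrow> \<Theta> A xs = Some (digit A (digits_per_level (xs ! 0)) (xs ! 1))" for A xs
    by blast
  \<comment> \<open>The arguments are numerator, denominator and code of \<open>z\<close>; for
    \<open>\<epsilon> = 1 / m\<close> the denominator, at index 1, is \<open>m\<close>.\<close>
  have "computable 3 (\<lambda>A \<rho>. colour A (digits_per_level (\<rho> 1)) (\<rho> 2))"
    by (intro computable_intros) auto
  from computable_turing_functional[OF this] obtain \<Phi> where \<Phi>: "turing_functional \<Phi>"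
    "length xs = 3 \<Longrightarrow> \<Phi> A xs = Some (colour A (digits_per_level (xs ! 1)) (xs ! 2))" for A xs
    by blast
  \<comment> \<open>\<open>1 / c\<close> is twice 3072: the \<open>2 * 2 ^ q\<close> colours fit,
    and the bound on the infimum becomes strict.\<close>
  define c :: real where "c = 1 / 6144"
  show ?thesis
  proof (rule exI[of _ c], rule conjI, goal_cases)
    case 1
    show ?case by (simp add: c_def)
  next
    case 2
    show ?case
    proof (rule exI[of _ \<Theta>], rule exI[of _ \<Phi>], intro conjI allI impI)
      fix m :: nat and \<epsilon> :: rat and n :: "nat \<Rightarrow> nat" and S :: "nat set"
      assume m2: "m \<ge> 2" and \<epsilon>: "\<epsilon> = 1 / of_nat m" and n_pos: "\<forall>i\<ge>1. n i > 0"
        and lac: "lacunary (1 + 1 / real m) n" and S: "S = n ` {1..}"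
      define q where "q = digits_per_level m"
      define b where "b = digit (set_oracle S) q"
      interpret lacunary_cells m q "2 ^ q" n "set_oracle S"
        using m2 n_pos lac digits_per_level_large[OF m2]
        by unfold_locales (auto simp: q_def S set_oracle_def)
      have "range b \<subseteq> {0, 1}" by (auto simp: b_def digit_def)
      then obtain \<theta> where \<theta>: "binary_expansion b \<theta>" using ex_binary_expansion by blast
      have \<epsilon>_real: "real_of_rat \<epsilon> = 1 / real m" by (simp add: \<epsilon> of_rat_divide)
      have ln_pos: "ln (real m) > 0" using m2 by simp
      have abs_ln: "\<bar>ln (1 / real m)\<bar> = ln (real m)"
        using m2 ln_pos by (simp add: ln_div)
      have qm: "2 ^ q \<le> 3072 * real m * ln (real m)"
        unfolding q_def by (rule digits_per_level_ln[OF m2])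
      have "quotient_of \<epsilon> = (1, int m)"
        using m2 quotient_of_Fract[of 1 "int m"]
        by (simp add: \<epsilon> Fract_of_int_quotient Rat.normalize_def)
      then have args: "pos_rat_args \<epsilon> = [1, m]" by (simp add: pos_rat_args_def)
      show "\<exists>b \<theta>.
        (\<forall>k. \<Theta> (set_oracle S) [m, k] = Some (b k)) \<and> binary_expansion b \<theta> \<and>
        0 < \<theta> \<and> \<theta> < 1 \<and>
        (INF j\<in>{1..}. dist_nearest_int (\<theta> * real (n j)))
          > c * real_of_rat \<epsilon> * inverse \<bar>ln (real_of_rat \<epsilon>)\<bar> \<and>
        (\<exists>\<chi>::int \<Rightarrow> nat.
          (\<forall>z. \<Phi> b (pos_rat_args \<epsilon> @ [int_encode z]) = Some (\<chi> z)) \<and>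
          (\<forall>z. int (\<chi> z) \<in> {1..\<lceil>inverse c * inverse (real_of_rat \<epsilon>) * \<bar>ln (real_of_rat \<epsilon>)\<bar>\<rceil>}) \<and>
          proper_coloring (cayley_edges S) \<chi>)"
      proof (intro exI[of _ b] exI[of _ \<theta>] exI[of _ "\<lambda>z. colour b q (int_encode z)"] conjI allI)
        show "\<Theta> (set_oracle S) [m, k] = Some (b k)" for k
          by (simp add: \<Theta>(2) b_def q_def)
        show "binary_expansion b \<theta>" by fact
        show "0 < \<theta>" "\<theta> < 1" using expansion_in_unit_interval \<theta> by (auto simp: b_def)
        have "0 < real m * ln (real m)" using m2 ln_pos by simp
        with qm have "2 ^ q < 6144 * (real m * ln (real m))" by (simp add: mult.assoc)
        then have "c * (1 / real m) * inverse (ln (real m)) < 1 / 2 ^ q"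
          using m2 ln_pos by (simp add: c_def field_simps)
        also have "1 / 2 ^ q \<le> (INF j\<in>{1..}. dist_nearest_int (\<theta> * real (n j)))"
        proof (rule cINF_greatest)
          show "1 / 2 ^ q \<le> dist_nearest_int (\<theta> * real (n j))" if "j \<in> {1..}" for j
            using dist_ge[of \<theta> j] \<theta> that by (simp add: b_def dist_nearest_int_def)
        qed simp
        finally show "(INF j\<in>{1..}. dist_nearest_int (\<theta> * real (n j)))
          > c * real_of_rat \<epsilon> * inverse \<bar>ln (real_of_rat \<epsilon>)\<bar>"
          by (simp only: \<epsilon>_real abs_ln)
        show "\<Phi> b (pos_rat_args \<epsilon> @ [int_encode z]) = Some (colour b q (int_encode z))" for z
          by (simp add: \<Phi>(2) args q_def)
        show "int (colour b q (int_encode z))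
            \<in> {1..\<lceil>inverse c * inverse (real_of_rat \<epsilon>) * \<bar>ln (real_of_rat \<epsilon>)\<bar>\<rceil>}" for z
        proof -
          have "real (colour b q (int_encode z)) \<le> real (2 ^ Suc q)"
            using colour_le by (simp only: of_nat_le_iff)
          also have "\<dots> \<le> inverse c * inverse (real_of_rat \<epsilon>) * \<bar>ln (real_of_rat \<epsilon>)\<bar>"
            unfolding \<epsilon>_real abs_ln using qm by (simp add: c_def)
          finally have "int (colour b q (int_encode z))
              \<le> \<lceil>inverse c * inverse (real_of_rat \<epsilon>) * \<bar>ln (real_of_rat \<epsilon>)\<bar>\<rceil>"
            by linarith
          then show ?thesis by (simp add: colour_def)
        qed
        show "proper_coloring (cayley_edges S) (\<lambda>z. colour b q (int_encode z))"
          unfolding proper_coloring_def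
        proof (safe)
          fix x y assume "(x, y) \<in> cayley_edges S"
            and eq: "colour b q (int_encode x) = colour b q (int_encode y)"
          then obtain j where j: "j \<ge> 1" "\<bar>x - y\<bar> = int (n j)"
            by (auto simp: cayley_edges_def S)
          obtain t :: int where t: "\<bar>\<theta> * of_int (x - y) - of_int t\<bar> < 1 / 2 ^ q"
            using colour_eq_imp[OF \<theta> eq] by blast
          have far: "1 / 2 ^ q \<le> \<bar>\<theta> * real (n j) - of_int t\<bar>" for t
            using dist_ge[of \<theta> j t] \<theta> j(1) by (simp add: b_def)
          show False
          proof (cases "x \<ge> y")
            case True
            then have "of_int (x - y) = real (n j)" using j(2) by linarith
            then show False using t far[of t] by simp
          next
            case False
            then have "of_int (x - y) = - real (n j)" using j(2) by linarith
            then show False using t far[of "- t"] by simp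
          qed
        qed
      qed
    qed (fact \<Theta>(1) \<Phi>(1))+
  qed
qed

end
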